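(* Let $n\ge1$, let $\alpha={}^t(a_1,\dots,a_n)\in\mathbb{C}^n$, $\beta={}^t(b_1,\dots,b_n)\in\mathbb{C}^n$ and $A\in M_n(\mathbb{C})$. Let $B\in M_{n^2}(\mathbb{C})=M_n(M_n(\mathbb{C}))$ be the block matrix whose $(i,j)$ block is $a_i\overline{b_j}A$: $$B=\begin{pmatrix}a_1\overline{b_1}A&\cdots&a_1\overline{b_n}A\\ \vdots&\ddots&\vdots\\ a_n\overline{b_1}A&\cdots&a_n\overline{b_n}A\end{pmatrix}.$$ Then: (1) $\|B\|_{p,p}=\|\alpha\|_p\,\|\beta\|_q\,\|A\|_{p,p}$ for all $p,q\in[1,\infty]$ with $\frac1p+\frac1q=1$. (2) $B\in LA(n^2)$ if and only if all of the matrices $C(\alpha)$, $R(\beta)$, $A$ belong to $LA(n)$.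
   Context: For $\xi=(x_1,\dots,x_m)\in\mathbb{C}^m$, $\|\xi\|_p=(\sum_{i=1}^m|x_i|^p)^{1/p}$ for $1\le p<\infty$ and $\|\xi\|_\infty=\max_i|x_i|$. For $T\in M_m(\mathbb{C})$, $\|T\|_{p,p}=\sup\{\|T\xi\|_p:\xi\in\mathbb{C}^m,\ \|\xi\|_p=1\}$. A matrix $T\in M_m(\mathbb{C})$ is called logarithmic affine, written $T\in LA(m)$, if $\|T\|_{p,p}=\|T\|_{1,1}^{1/p}\|T\|_{\infty,\infty}^{1-1/p}$ for every $p\in[1,\infty]$ (with $1/\infty=0$ and $0^0=1$). For $\xi={}^t(x_1,\dots,x_n)\in\mathbb{C}^n$, $C(\xi)\in M_n(\mathbb{C})$ is the matrix whose first column is $\xi$ and whose other columns are zero, and $R(\xi)\in M_n(\mathbb{C})$ is the matrix whose first row is $(\overline{x_1},\dots,\overline{x_n})$ and whose other rows are zero.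
   Formalization: In (2) the "only if" direction is stated only when B is nonzero or n = 1, since for n ≥ 2 it fails at B = 0 (e.g. n = 2, α = 0, A = 0, β = (1,2): B = 0 is in LA(4) but R(β) is not in LA(2)); the "if" direction is unrestricted. *)

theory Defs
  imports Complex_Main "HOL-Library.Extended_Real" "Jordan_Normal_Form.Matrix"
begin

text \<open>Exponents range over \<open>[1, \<infinity>]\<close>, taken inside \<^typ>\<open>ereal\<close>, where \<open>1 / \<infinity> = 0\<close>.
  Vectors and matrices are indexed from \<open>0\<close>. All notions below are meant for dimension at
  least \<open>1\<close>, as the maximum and the supremum are unspecified in dimension \<open>0\<close>.\<close>

definition lp_norm :: "ereal \<Rightarrow> complex vec \<Rightarrow> real" where
  "lp_norm p v =
     (if p = \<infinity> then Max ((\<lambda>i. cmod (v $ i)) ` {..<dim_vec v})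
      else (\<Sum>i<dim_vec v. cmod (v $ i) powr real_of_ereal p) powr (1 / real_of_ereal p))"

definition op_norm :: "ereal \<Rightarrow> complex mat \<Rightarrow> real" where
  "op_norm p T =
     Sup {lp_norm p (T *\<^sub>v x) | x. x \<in> carrier_vec (dim_col T) \<and> lp_norm p x = 1}"

text \<open>The library has \<open>0 powr 0 = 0\<close>; the convention needed here is \<open>0\<^sup>0 = 1\<close>.\<close>

definition rpow :: "real \<Rightarrow> real \<Rightarrow> real" where
  "rpow x s = (if s = 0 then 1 else x powr s)"

definition LA :: "nat \<Rightarrow> complex mat set" where
  "LA m = {T \<in> carrier_mat m m. \<forall>p. 1 \<le> p \<longrightarrow>
     op_norm p T = rpow (op_norm 1 T) (real_of_ereal (1 / p))
                   * rpow (op_norm \<infinity> T) (1 - real_of_ereal (1 / p))}"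

definition first_col_mat :: "complex vec \<Rightarrow> complex mat" where
  "first_col_mat x = mat (dim_vec x) (dim_vec x) (\<lambda>(i, j). if j = 0 then x $ i else 0)"

definition first_row_mat :: "complex vec \<Rightarrow> complex mat" where
  "first_row_mat x = mat (dim_vec x) (dim_vec x) (\<lambda>(i, j). if i = 0 then cnj (x $ j) else 0)"

text \<open>The identification of \<open>M\<^sub>n(M\<^sub>n(\<complex>))\<close> with the square matrices of size \<open>n * n\<close>:
  the \<open>(k, l)\<close> entry of the block \<open>F i j\<close> is placed at position \<open>(i * n + k, j * n + l)\<close>.\<close>

definition block_mat :: "nat \<Rightarrow> (nat \<Rightarrow> nat \<Rightarrow> complex mat) \<Rightarrow> complex mat" where
  "block_mat n F =
     mat (n * n) (n * n) (\<lambda>(r, c). F (r div n) (c div n) $$ (r mod n, c mod n))"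

end

theory Submission
  imports Defs "HOL-Analysis.Convex"
begin

text \<open>
  The matrix \<open>B\<close> is the Kronecker product of the rank-one matrix \<open>\<alpha> \<beta>\<^sup>*\<close> with \<open>A\<close>. Cut a vector \<open>x\<close> of
  length \<open>n\<^sup>2\<close> into blocks \<open>x\<^sub>0, x\<^sub>1, \<dots>\<close> of length \<open>n\<close> and put \<open>y = \<Sum>\<^sub>j cnj b\<^sub>j x\<^sub>j\<close>. Then
  \<open>B x = \<alpha> \<otimes> A y\<close>, so \<open>\<parallel>B x\<parallel>\<^sub>p = \<parallel>\<alpha>\<parallel>\<^sub>p \<parallel>A y\<parallel>\<^sub>p\<close>, while Holder's inequality gives
  \<open>\<parallel>y\<parallel>\<^sub>p \<le> \<parallel>\<beta>\<parallel>\<^sub>q \<parallel>x\<parallel>\<^sub>p\<close>, with equality for suitable \<open>x = u \<otimes> \<xi>\<close>. This is the product formula for the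
  norm, proved in \<open>op_norm_rank_one_kron\<close> for factors of arbitrary sizes.

  The matrices \<open>C(\<alpha>)\<close> and \<open>R(\<beta>)\<close> have the same shape: they are \<open>\<alpha> e\<^sup>*\<close> and \<open>e \<beta>\<^sup>*\<close> with \<open>e\<close> the first unit
  vector. The product formula therefore also shows that their norms are \<open>\<parallel>\<alpha>\<parallel>\<^sub>p\<close> and \<open>\<parallel>\<beta>\<parallel>\<^sub>q\<close>, and the norm
  of \<open>B\<close> is the product of the norms of \<open>C(\<alpha>)\<close>, \<open>R(\<beta>)\<close> and \<open>A\<close> for every \<open>p\<close>. Multiplying the three
  equations that define logarithmic affinity of the factors yields the one for \<open>B\<close>.

  For the converse, every matrix satisfies one half of the defining equation,
  \<open>\<parallel>T\<parallel>\<^sub>p \<le> \<parallel>T\<parallel>\<^sub>1\<^sup>1\<^sup>/\<^sup>p \<parallel>T\<parallel>\<^sub>\<infinity>\<^sup>1\<^sup>-\<^sup>1\<^sup>/\<^sup>p\<close> (\<open>op_norm_interpolation\<close>, by Schur's test). If \<open>B\<close> is logarithmic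
  affine, then the product of these three inequalities is an equality. If in addition \<open>B\<close> is nonzero,
  then all factors are positive and each inequality must be an equality. If \<open>B\<close> is zero, then one factor
  vanishes and the equation for \<open>B\<close> says nothing about the other two; but in dimension \<open>1\<close> the
  equivalence persists, since all \<open>1 \<times> 1\<close> matrices are logarithmic affine.
\<close>

section \<open>Conjugate exponents\<close>

lemma extended_exponent_cases:
  fixes p :: ereal
  assumes "1 \<le> p"
  obtains (infinite) "p = \<infinity>" | (finite) r where "p = ereal r" "1 \<le> r"
  using assms by (cases p) auto

lemma conjugate_exponents_cases:
  fixes p q :: ereal
  assumes p: "1 \<le> p" and q: "1 \<le> q" and pq: "1 / p + 1 / q = 1"
  obtains (one_infinity) "p = 1" "q = \<infinity>"
    | (infinity_one) "p = \<infinity>" "q = 1"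
    | (finite) r s where "p = ereal r" "q = ereal s" "1 < r" "1 < s" "1 / r + 1 / s = 1"
proof -
  show thesis
    using p
  proof (cases rule: extended_exponent_cases)
    case pinf: infinite
    show thesis using q
    proof (cases rule: extended_exponent_cases)
      case infinite
      then show thesis using pq pinf by simp
    next
      case (finite s)
      then have "1 / s = 1"
        using pq pinf by (simp add: one_ereal_def)
      then have "s = 1" by simp
      then show thesis using pinf finite infinity_one by (simp add: one_ereal_def)
    qed
  next
    case pfin: (finite r)
    show thesis using q
    proof (cases rule: extended_exponent_cases)
      case infinite
      then have "1 / r = 1"
        using pq pfin by (simp add: one_ereal_def)
      then have "r = 1" by simp
      then show thesis using pfin infinite one_infinity by (simp add: one_ereal_def)
    next
      case qfin: (finite s)
      have rs: "1 / r + 1 / s = 1"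
        using pq pfin qfin by (simp add: one_ereal_def)
      moreover have "r \<noteq> 1" "s \<noteq> 1" using rs pfin qfin by auto
      ultimately show thesis using pfin qfin finite by force
    qed
  qed
qed

lemma conjugate_exponent_exists:
  fixes p :: ereal
  assumes "1 \<le> p"
  obtains q :: ereal where "1 \<le> q" "1 / p + 1 / q = 1"
  using assms
proof (cases rule: extended_exponent_cases)
  case infinite
  then show thesis using that[of 1] by simp
next
  case (finite r)
  show thesis
  proof (cases "r = 1")
    case True
    then show thesis using that[of \<infinity>] finite by (simp add: one_ereal_def)
  next
    case False
    then have r: "1 < r" using finite by simp
    have "1 \<le> ereal (r / (r - 1))" using r by (simp add: one_ereal_def)
    moreover have "1 / p + 1 / ereal (r / (r - 1)) = 1"
      using r finite by (simp add: one_ereal_def field_simps)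
    ultimately show thesis by (rule that)
  qed
qed

section \<open>The \<open>p\<close>-norms of complex vectors\<close>

lemma lp_norm_ereal:
  "lp_norm (ereal r) v = (\<Sum>i<dim_vec v. cmod (v $ i) powr r) powr (1 / r)"
  by (simp add: lp_norm_def)

lemma lp_norm_one: "lp_norm 1 v = (\<Sum>i<dim_vec v. cmod (v $ i))"
  by (simp add: one_ereal_def lp_norm_ereal sum_nonneg)

lemma lp_norm_ereal_powr:
  "1 \<le> r \<Longrightarrow> lp_norm (ereal r) v powr r = (\<Sum>i<dim_vec v. cmod (v $ i) powr r)"
  by (simp add: lp_norm_ereal powr_powr sum_nonneg)

lemma lp_norm_infinity_le_iff:
  assumes "0 < dim_vec v"
  shows "lp_norm \<infinity> v \<le> K \<longleftrightarrow> (\<forall>i<dim_vec v. cmod (v $ i) \<le> K)"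
proof -
  have "{..<dim_vec v} \<noteq> {}" using assms by auto
  then show ?thesis by (auto simp: lp_norm_def)
qed

lemma cmod_component_le_lp_norm:
  assumes p: "1 \<le> p" and i: "i < dim_vec v"
  shows "cmod (v $ i) \<le> lp_norm p v"
  using p
proof (cases rule: extended_exponent_cases)
  case infinite
  then show ?thesis using lp_norm_infinity_le_iff[of v "lp_norm p v"] i by auto
next
  case (finite r)
  have "cmod (v $ i) powr r \<le> (\<Sum>i<dim_vec v. cmod (v $ i) powr r)"
    using i by (intro member_le_sum) auto
  then have "(cmod (v $ i) powr r) powr (1 / r) \<le> lp_norm p v"
    unfolding finite(1) lp_norm_ereal using finite(2) by (intro powr_mono2) auto
  then show ?thesis using finite(2) by (simp add: powr_powr)
qed

lemma lp_norm_nonneg: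
  assumes "1 \<le> p" "0 < dim_vec v"
  shows "0 \<le> lp_norm p v"
  using cmod_component_le_lp_norm[OF assms] norm_ge_zero order_trans by blast

lemma lp_norm_mono:
  assumes p: "1 \<le> p" and n: "0 < dim_vec v" "dim_vec w = dim_vec v"
    and le: "\<And>i. i < dim_vec v \<Longrightarrow> cmod (v $ i) \<le> cmod (w $ i)"
  shows "lp_norm p v \<le> lp_norm p w"
  using p
proof (cases rule: extended_exponent_cases)
  case infinite
  then show ?thesis
    using lp_norm_infinity_le_iff[of v "lp_norm p w"] n le
      cmod_component_le_lp_norm[OF p, of _ w] by (metis order_trans)
next
  case (finite r)
  then show ?thesis
    unfolding finite(1) lp_norm_ereal n(2) using le
    by (intro powr_mono2 sum_mono sum_nonneg) auto
qed

lemma lp_norm_cong_cmod: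
  assumes "1 \<le> p" "0 < dim_vec v" "dim_vec w = dim_vec v"
    and "\<And>i. i < dim_vec v \<Longrightarrow> cmod (v $ i) = cmod (w $ i)"
  shows "lp_norm p v = lp_norm p w"
  using assms by (intro antisym lp_norm_mono) auto

lemma lp_norm_smult:
  assumes p: "1 \<le> p" and n: "0 < dim_vec v"
  shows "lp_norm p (c \<cdot>\<^sub>v v) = cmod c * lp_norm p v"
  using p
proof (cases rule: extended_exponent_cases)
  case infinite
  have ne: "{..<dim_vec v} \<noteq> {}" using n by auto
  have "Max ((\<lambda>i. cmod c * cmod (v $ i)) ` {..<dim_vec v})
      = cmod c * Max ((\<lambda>i. cmod (v $ i)) ` {..<dim_vec v})"
    using mono_Max_commute[of "\<lambda>x. cmod c * x" "(\<lambda>i. cmod (v $ i)) ` {..<dim_vec v}"] ne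
    by (simp add: mono_def mult_left_mono image_image)
  moreover have "(\<lambda>i. cmod ((c \<cdot>\<^sub>v v) $ i)) ` {..<dim_vec v} = (\<lambda>i. cmod c * cmod (v $ i)) ` {..<dim_vec v}"
    by (intro image_cong) (auto simp: norm_mult)
  ultimately show ?thesis
    using infinite by (simp add: lp_norm_def)
next
  case (finite r)
  then show ?thesis
    by (simp add: lp_norm_ereal norm_mult powr_mult sum_nonneg powr_powr
        flip: sum_distrib_left)
qed

lemma lp_norm_eq_0_iff:
  assumes p: "1 \<le> p" and v: "v \<in> carrier_vec n" and n: "0 < n"
  shows "lp_norm p v = 0 \<longleftrightarrow> v = 0\<^sub>v n"
proof
  assume "lp_norm p v = 0"
  then have "v $ i = 0" if "i < n" for i
    using cmod_component_le_lp_norm[OF p, of i v] that v by simp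
  then show "v = 0\<^sub>v n" using v by (intro eq_vecI) auto
next
  assume v0: "v = 0\<^sub>v n"
  have "lp_norm p (0 \<cdot>\<^sub>v v) = 0" using lp_norm_smult[OF p, of v 0] n v by simp
  also have "0 \<cdot>\<^sub>v v = v" unfolding v0 by (intro eq_vecI) auto
  finally show "lp_norm p v = 0" .
qed

lemma lp_norm_pos:
  assumes p: "1 \<le> p" and v: "v \<in> carrier_vec n" and n: "0 < n" and "v \<noteq> 0\<^sub>v n"
  shows "0 < lp_norm p v"
  using lp_norm_eq_0_iff[OF p v n] lp_norm_nonneg[OF p, of v] assms by force

lemma lp_norm_unit_vec:
  assumes p: "1 \<le> p" and i: "i < n"
  shows "lp_norm p (unit_vec n i) = 1"
  using p
proof (cases rule: extended_exponent_cases)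
  case infinite
  have "lp_norm \<infinity> (unit_vec n i :: complex vec) \<le> 1"
    using i by (subst lp_norm_infinity_le_iff) auto
  moreover have "1 \<le> lp_norm \<infinity> (unit_vec n i :: complex vec)"
    using cmod_component_le_lp_norm[of \<infinity> i "unit_vec n i"] i by simp
  ultimately show ?thesis using infinite by simp
next
  case (finite r)
  have "(\<Sum>j<n. cmod ((unit_vec n i :: complex vec) $ j) powr r) = (\<Sum>j<n. if j = i then 1 else 0)"
    using i by (intro sum.cong) auto
  also have "\<dots> = 1" using i by simp
  finally show ?thesis using finite by (simp add: lp_norm_ereal)
qed

section \<open>Holder's inequality and its case of equality\<close>

text \<open>Young's inequality is applied termwise after both families are scaled to norm \<open>1\<close>; summed up,
  its right-hand side becomes \<open>1 / r + 1 / s = 1\<close>. If one norm vanishes, scaling is impossible, but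
  then every term of the left-hand sum is zero.\<close>

lemma Holder_inequality_sum:
  fixes a b :: "'a \<Rightarrow> real"
  assumes r: "1 < r" "1 < s" "1 / r + 1 / s = 1"
    and a: "\<And>i. i \<in> I \<Longrightarrow> 0 \<le> a i" and b: "\<And>i. i \<in> I \<Longrightarrow> 0 \<le> b i"
  shows "(\<Sum>i\<in>I. a i * b i) \<le> (\<Sum>i\<in>I. a i powr r) powr (1 / r) * (\<Sum>i\<in>I. b i powr s) powr (1 / s)"
proof (cases "finite I")
  case True
  define X where "X = (\<Sum>i\<in>I. a i powr r)"
  define Y where "Y = (\<Sum>i\<in>I. b i powr s)"
  have nn: "0 \<le> X" "0 \<le> Y" unfolding X_def Y_def by (auto intro: sum_nonneg)
  show ?thesis
  proof (cases "X = 0 \<or> Y = 0")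
    case deg: True
    have "a i * b i = 0" if i: "i \<in> I" for i
      using deg
    proof
      assume "X = 0"
      then have "a i powr r = 0"
        using True i unfolding X_def by (subst (asm) sum_nonneg_eq_0_iff) auto
      then show ?thesis by simp
    next
      assume "Y = 0"
      then have "b i powr s = 0"
        using True i unfolding Y_def by (subst (asm) sum_nonneg_eq_0_iff) auto
      then show ?thesis by simp
    qed
    then have "(\<Sum>i\<in>I. a i * b i) = 0" by (intro sum.neutral) blast
    also have "0 \<le> X powr (1 / r) * Y powr (1 / s)" by simp
    finally show ?thesis unfolding X_def Y_def .
  next
    case False
    then have pos: "0 < X" "0 < Y" using nn by auto
    define x where "x = X powr (1 / r)"
    define y where "y = Y powr (1 / s)"
    have xy: "0 < x" "0 < y" "x powr r = X" "y powr s = Y"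
      using pos r by (auto simp: x_def y_def powr_powr)
    have "(\<Sum>i\<in>I. (a i / x) * (b i / y)) \<le> (\<Sum>i\<in>I. (a i / x) powr r / r + (b i / y) powr s / s)"
      using a b xy r by (intro sum_mono Youngs_inequality) auto
    also have "\<dots> = (\<Sum>i\<in>I. a i powr r / X / r + b i powr s / Y / s)"
      using a b xy by (intro sum.cong) (auto simp: powr_divide)
    also have "\<dots> = X / X / r + Y / Y / s"
      unfolding X_def Y_def by (simp add: sum.distrib flip: sum_divide_distrib)
    also have "\<dots> = 1" using pos r by simp
    also have "(\<Sum>i\<in>I. (a i / x) * (b i / y)) = (\<Sum>i\<in>I. a i * b i) / (x * y)"
      by (simp add: sum_divide_distrib)
    finally have "(\<Sum>i\<in>I. a i * b i) \<le> x * y" using xy by (simp add: divide_le_eq)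
    then show ?thesis unfolding x_def y_def X_def Y_def .
  qed
qed simp

lemma lp_norm_Holder:
  assumes pq: "1 \<le> p" "1 \<le> q" "1 / p + 1 / q = 1" and n: "0 < n"
    and b: "b \<in> carrier_vec n" and x: "x \<in> carrier_vec n"
  shows "cmod (\<Sum>j<n. cnj (b $ j) * x $ j) \<le> lp_norm q b * lp_norm p x"
proof -
  have "cmod (\<Sum>j<n. cnj (b $ j) * x $ j) \<le> (\<Sum>j<n. cmod (b $ j) * cmod (x $ j))"
    by (rule order_trans[OF norm_sum]) (simp add: norm_mult)
  also have "\<dots> \<le> lp_norm q b * lp_norm p x"
    using pq
  proof (cases rule: conjugate_exponents_cases)
    case one_infinity
    have "(\<Sum>j<n. cmod (b $ j) * cmod (x $ j)) \<le> (\<Sum>j<n. lp_norm q b * cmod (x $ j))"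
      using cmod_component_le_lp_norm[OF pq(2), of _ b] b
      by (intro sum_mono mult_right_mono) auto
    then show ?thesis using one_infinity x by (simp add: lp_norm_one sum_distrib_left)
  next
    case infinity_one
    have "(\<Sum>j<n. cmod (b $ j) * cmod (x $ j)) \<le> (\<Sum>j<n. cmod (b $ j) * lp_norm p x)"
      using cmod_component_le_lp_norm[OF pq(1), of _ x] x
      by (intro sum_mono mult_left_mono) auto
    then show ?thesis using infinity_one b by (simp add: lp_norm_one sum_distrib_right)
  next
    case (finite r s)
    then show ?thesis
      using Holder_inequality_sum[of s r "{..<n}" "\<lambda>j. cmod (b $ j)" "\<lambda>j. cmod (x $ j)"] b x
      by (simp add: lp_norm_ereal add.commute)
  qed
  finally show ?thesis .
qed

text \<open>Duality of \<open>p\<close> and \<open>q\<close> in finite dimension. For \<open>b \<noteq> 0\<close>, the extremal vector carries the phases of \<open>b\<close>, which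
  turn the sum into one of moduli, while its own moduli depend on \<open>p\<close>: all mass at a largest entry
  of \<open>b\<close> if \<open>p = 1\<close>, constant if \<open>p = \<infinity>\<close>, and proportional to \<open>\<bar>b\<^sub>j\<bar>\<close> to the power \<open>q - 1\<close> in between.\<close>

lemma lp_norm_Holder_attained:
  assumes pq: "1 \<le> p" "1 \<le> q" "1 / p + 1 / q = 1" and n: "0 < n"
    and b: "b \<in> carrier_vec n"
  obtains x where "x \<in> carrier_vec n" "lp_norm p x = 1"
    "(\<Sum>j<n. cnj (b $ j) * x $ j) = of_real (lp_norm q b)"
proof (cases "b = 0\<^sub>v n")
  case True
  have "lp_norm q b = 0" using True lp_norm_eq_0_iff[OF pq(2) b n] by simp
  then show thesis
    using True n pq by (intro that[of "unit_vec n 0"]) (auto simp: lp_norm_unit_vec)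
next
  case False
  \<comment> \<open>Zero entries receive the phase \<open>1\<close>, so that the vector of phases has norm \<open>1\<close> for \<open>p = \<infinity>\<close>.\<close>
  define \<theta> where "\<theta> j = (if b $ j = 0 then 1 else sgn (b $ j))" for j
  have \<theta>: "cmod (\<theta> j) = 1" "cnj (b $ j) * \<theta> j = of_real (cmod (b $ j))" for j
  proof -
    show "cmod (\<theta> j) = 1" by (simp add: \<theta>_def norm_sgn)
    have "cnj (b $ j) * (b $ j / of_real (cmod (b $ j)))
        = of_real ((cmod (b $ j))\<^sup>2) / of_real (cmod (b $ j))"
      unfolding complex_norm_square by simp
    then show "cnj (b $ j) * \<theta> j = of_real (cmod (b $ j))"
      by (simp add: \<theta>_def sgn_eq power2_eq_square)
  qed
  show thesis
    using pq
  proof (cases rule: conjugate_exponents_cases)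
    case one_infinity
    have "lp_norm q b \<in> (\<lambda>i. cmod (b $ i)) ` {..<n}"
    proof -
      have "(\<lambda>i. cmod (b $ i)) ` {..<n} \<noteq> {}" using n by blast
      from Max_in[OF _ this] show ?thesis
        using one_infinity b by (simp add: lp_norm_def)
    qed
    then obtain i where i: "i < n" "cmod (b $ i) = lp_norm q b" by auto
    have "(\<Sum>j<n. cnj (b $ j) * (\<theta> i \<cdot>\<^sub>v unit_vec n i) $ j)
        = (\<Sum>j<n. if j = i then cnj (b $ i) * \<theta> i else 0)"
      using i by (intro sum.cong) auto
    also have "\<dots> = of_real (lp_norm q b)" using i \<theta> by simp
    finally show thesis
      using i \<theta> pq by (intro that[of "\<theta> i \<cdot>\<^sub>v unit_vec n i"])
        (auto simp: lp_norm_smult lp_norm_unit_vec)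
  next
    case infinity_one
    have 1: "lp_norm p (vec n \<theta>) = 1"
    proof (rule antisym)
      show "lp_norm p (vec n \<theta>) \<le> 1"
        using n \<theta> by (simp add: infinity_one lp_norm_infinity_le_iff)
      show "1 \<le> lp_norm p (vec n \<theta>)"
        using cmod_component_le_lp_norm[of p 0 "vec n \<theta>"] n \<theta> pq by simp
    qed
    show thesis
      using 1 b \<theta> pq infinity_one
      by (intro that[of "vec n \<theta>"]) (auto simp: lp_norm_unit_vec lp_norm_one)
  next
    case (finite r s)
    define N where "N = lp_norm q b"
    have N: "0 < N"
      unfolding N_def using pq(2) b n False by (rule lp_norm_pos)
    have sum_b: "(\<Sum>j<n. cmod (b $ j) powr s) = N powr s"
      using lp_norm_ereal_powr[of s b] finite b by (simp add: N_def)
    have rs: "(s - 1) * r = s" using finite by (simp add: field_simps)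
    define x where "x = vec n (\<lambda>j. of_real ((cmod (b $ j) / N) powr (s - 1)) * \<theta> j)"
    have "(\<Sum>j<n. cmod (x $ j) powr r) = (\<Sum>j<n. cmod (b $ j) powr s / N powr s)"
      using N \<theta> by (intro sum.cong) (auto simp: x_def norm_mult norm_divide powr_powr rs powr_divide)
    also have "\<dots> = 1" using sum_b N by (simp flip: sum_divide_distrib)
    finally have "lp_norm p x = 1" using finite by (simp add: lp_norm_ereal x_def)
    moreover have "(\<Sum>j<n. cnj (b $ j) * x $ j) = of_real N"
    proof -
      have "(\<Sum>j<n. cnj (b $ j) * x $ j)
          = (\<Sum>j<n. of_real (N * (cmod (b $ j) powr s / N powr s)))"
      proof (intro sum.cong refl)
        fix j assume j: "j \<in> {..<n}"
        have "cmod (b $ j) * (cmod (b $ j) / N) powr (s - 1) = N * (cmod (b $ j) powr s / N powr s)"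
          using N finite by (cases "b $ j = 0") (auto simp: powr_divide powr_diff)
        moreover have "cnj (b $ j) * x $ j = of_real (cmod (b $ j) * (cmod (b $ j) / N) powr (s - 1))"
        proof -
          have "cnj (b $ j) * x $ j
              = (cnj (b $ j) * \<theta> j) * of_real ((cmod (b $ j) / N) powr (s - 1))"
            using j by (simp add: x_def)
          then show ?thesis unfolding \<theta>(2) of_real_mult .
        qed
        ultimately show "cnj (b $ j) * x $ j = of_real (N * (cmod (b $ j) powr s / N powr s))"
          by simp
      qed
      also have "\<dots> = of_real (N * ((\<Sum>j<n. cmod (b $ j) powr s) / N powr s))"
        by (simp add: sum_distrib_left sum_divide_distrib)
      also have "\<dots> = of_real N" using sum_b N by simp
      finally show ?thesis .
    qed
    ultimately show thesis by (intro that[of x]) (auto simp: x_def N_def)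
  qed
qed

section \<open>Schur's test and interpolation of operator norms\<close>

lemma lp_norm_mult_mat_vec_homogeneous_le:
  assumes p: "1 \<le> p" and T: "T \<in> carrier_mat m k" and m: "0 < m" and k: "0 < k"
    and x: "x \<in> carrier_vec k"
    and K: "\<And>x. x \<in> carrier_vec k \<Longrightarrow> lp_norm p x = 1 \<Longrightarrow> lp_norm p (T *\<^sub>v x) \<le> K"
  shows "lp_norm p (T *\<^sub>v x) \<le> K * lp_norm p x"
proof (cases "x = 0\<^sub>v k")
  case True
  then have "T *\<^sub>v x = 0\<^sub>v m" using T by (auto simp: scalar_prod_def)
  then show ?thesis
    using True lp_norm_eq_0_iff[OF p x k] lp_norm_eq_0_iff[OF p zero_carrier_vec m] by simp
next
  case False
  define N where "N = lp_norm p x"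
  have N: "0 < N"
    unfolding N_def using p x k False by (rule lp_norm_pos)
  define y where "y = of_real (inverse N) \<cdot>\<^sub>v x"
  have y: "y \<in> carrier_vec k" "lp_norm p y = 1"
    using x k N p by (auto simp: y_def lp_norm_smult norm_inverse simp flip: N_def)
  have "inverse N * lp_norm p (T *\<^sub>v x) = lp_norm p (of_real (inverse N) \<cdot>\<^sub>v (T *\<^sub>v x))"
    using N p m T by (subst lp_norm_smult) (auto simp: norm_inverse)
  also have "of_real (inverse N) \<cdot>\<^sub>v (T *\<^sub>v x) = T *\<^sub>v y"
    unfolding y_def using T x by (simp add: mult_mat_vec)
  also have "lp_norm p (T *\<^sub>v y) \<le> K" using K y by blast
  finally show ?thesis using N by (simp add: field_simps flip: N_def)
qed

text \<open>Split each weight as \<open>\<bar>t\<^sub>i\<^sub>j\<bar> = \<bar>t\<^sub>i\<^sub>j\<bar>\<^sup>1\<^sup>/\<^sup>s \<bar>t\<^sub>i\<^sub>j\<bar>\<^sup>1\<^sup>/\<^sup>r\<close> with \<open>1 / r + 1 / s = 1\<close>. Holder's inequality in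
  row \<open>i\<close> then costs a power of the row sum and leaves \<open>\<Sum>\<^sub>j \<bar>t\<^sub>i\<^sub>j\<bar> \<bar>x\<^sub>j\<bar>\<^sup>r\<close>; summing this over \<open>i\<close> produces
  the column sums. At the end points \<open>1\<close> and \<open>\<infinity>\<close> only one of the two bounds enters, which is where
  the convention \<open>0\<^sup>0 = 1\<close> matters.\<close>

lemma Schur_test:
  assumes p: "1 \<le> p" and T: "T \<in> carrier_mat m k" and m: "0 < m" and k: "0 < k"
    and row: "\<And>i. i < m \<Longrightarrow> (\<Sum>j<k. cmod (T $$ (i, j))) \<le> R"
    and col: "\<And>j. j < k \<Longrightarrow> (\<Sum>i<m. cmod (T $$ (i, j))) \<le> C"
    and x: "x \<in> carrier_vec k"
  shows "lp_norm p (T *\<^sub>v x)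
    \<le> rpow C (real_of_ereal (1 / p)) * rpow R (1 - real_of_ereal (1 / p)) * lp_norm p x"
proof -
  have R: "0 \<le> R" by (rule order_trans[OF _ row[OF m]]) (simp add: sum_nonneg)
  have C: "0 \<le> C" by (rule order_trans[OF _ col[OF k]]) (simp add: sum_nonneg)
  have dims [simp]: "dim_vec x = k" "dim_row T = m" "dim_col T = k" using T x by auto
  have Tx: "cmod ((T *\<^sub>v x) $ i) \<le> (\<Sum>j<k. cmod (T $$ (i, j)) * cmod (x $ j))" if "i < m" for i
  proof -
    have "(T *\<^sub>v x) $ i = (\<Sum>j<k. T $$ (i, j) * x $ j)"
      using that by (simp add: scalar_prod_def atLeast0LessThan)
    then show ?thesis by (simp add: norm_mult sum_norm_le)
  qed
  \<comment> \<open>Summing over the rows first turns the weighted sums into column sums.\<close>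
  have swap: "(\<Sum>i<m. \<Sum>j<k. cmod (T $$ (i, j)) * f j) \<le> C * (\<Sum>j<k. f j)"
    if "\<And>j. 0 \<le> f j" for f
  proof -
    have "(\<Sum>i<m. \<Sum>j<k. cmod (T $$ (i, j)) * f j) = (\<Sum>j<k. (\<Sum>i<m. cmod (T $$ (i, j))) * f j)"
      by (subst sum.swap) (simp add: sum_distrib_right)
    also have "\<dots> \<le> (\<Sum>j<k. C * f j)"
      using that col by (intro sum_mono mult_right_mono) auto
    finally show ?thesis by (simp add: sum_distrib_left)
  qed
  show ?thesis
    using p
  proof (cases rule: extended_exponent_cases)
    case infinite
    have "cmod ((T *\<^sub>v x) $ i) \<le> R * lp_norm p x" if i: "i < m" for i
    proof -
      have "cmod ((T *\<^sub>v x) $ i) \<le> (\<Sum>j<k. cmod (T $$ (i, j)) * lp_norm p x)"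
        using p by (intro order_trans[OF Tx[OF i]] sum_mono mult_left_mono
            cmod_component_le_lp_norm) auto
      also have "\<dots> \<le> R * lp_norm p x"
        using row[OF i] lp_norm_nonneg[OF p, of x] k
        by (simp add: mult_right_mono flip: sum_distrib_right)
      finally show ?thesis .
    qed
    then show ?thesis
      using infinite m R by (simp add: lp_norm_infinity_le_iff rpow_def)
  next
    case (finite r)
    show ?thesis
    proof (cases "r = 1")
      case True
      have "lp_norm 1 (T *\<^sub>v x) \<le> (\<Sum>i<m. \<Sum>j<k. cmod (T $$ (i, j)) * cmod (x $ j))"
        unfolding lp_norm_one using Tx by (auto intro!: sum_mono)
      also have "\<dots> \<le> C * lp_norm 1 x" unfolding lp_norm_one using swap by simp
      finally show ?thesis using True finite C by (simp add: rpow_def one_ereal_def)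
    next
      case False
      then have r: "1 < r" using finite by simp
      define s where "s = r / (r - 1)"
      have s: "1 < s" "1 / s + 1 / r = 1" using r by (auto simp: s_def field_simps)
      have rs: "1 / s * r = r - 1" using r by (simp add: s_def)
      have Ti: "cmod ((T *\<^sub>v x) $ i) powr r
          \<le> R powr (r - 1) * (\<Sum>j<k. cmod (T $$ (i, j)) * cmod (x $ j) powr r)" if i: "i < m" for i
      proof -
        define t where "t j = cmod (T $$ (i, j))" for j
        have t: "0 \<le> t j" for j by (simp add: t_def)
        have "cmod ((T *\<^sub>v x) $ i) \<le> (\<Sum>j<k. t j * cmod (x $ j))"
          using Tx[OF i] by (simp add: t_def)
        also have "\<dots> = (\<Sum>j<k. t j powr (1 / s) * (t j powr (1 / r) * cmod (x $ j)))"
        proof (intro sum.cong refl)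
          fix j
          have "t j = t j powr (1 / s) * t j powr (1 / r)"
            using s t[of j] by (simp flip: powr_add)
          then show "t j * cmod (x $ j) = t j powr (1 / s) * (t j powr (1 / r) * cmod (x $ j))"
            by (metis mult.assoc)
        qed
        also have "\<dots> \<le> (\<Sum>j<k. (t j powr (1 / s)) powr s) powr (1 / s)
            * (\<Sum>j<k. (t j powr (1 / r) * cmod (x $ j)) powr r) powr (1 / r)"
          using r s by (intro Holder_inequality_sum) auto
        also have "\<dots> = (\<Sum>j<k. t j) powr (1 / s) * (\<Sum>j<k. t j * cmod (x $ j) powr r) powr (1 / r)"
          using r s t by (simp add: powr_powr powr_mult)
        also have "\<dots> \<le> R powr (1 / s) * (\<Sum>j<k. t j * cmod (x $ j) powr r) powr (1 / r)"
          using row[OF i] s t by (intro mult_right_mono powr_mono2) (auto simp: t_def sum_nonneg)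
        finally have "cmod ((T *\<^sub>v x) $ i) powr r
            \<le> (R powr (1 / s) * (\<Sum>j<k. t j * cmod (x $ j) powr r) powr (1 / r)) powr r"
          using r by (intro powr_mono2) auto
        also have "\<dots> = R powr (r - 1) * (\<Sum>j<k. t j * cmod (x $ j) powr r)"
          using r t R rs by (simp add: powr_mult powr_powr sum_nonneg)
        finally show ?thesis by (simp add: t_def)
      qed
      define S where "S = (\<Sum>j<k. cmod (x $ j) powr r)"
      have "(\<Sum>i<m. cmod ((T *\<^sub>v x) $ i) powr r)
          \<le> (\<Sum>i<m. R powr (r - 1) * (\<Sum>j<k. cmod (T $$ (i, j)) * cmod (x $ j) powr r))"
        using Ti by (intro sum_mono) auto
      also have "\<dots> \<le> R powr (r - 1) * (C * S)"
        using swap[of "\<lambda>j. cmod (x $ j) powr r"]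
        by (simp add: S_def mult_left_mono flip: sum_distrib_left)
      finally have "lp_norm p (T *\<^sub>v x) \<le> (R powr (r - 1) * (C * S)) powr (1 / r)"
        unfolding finite(1) lp_norm_ereal using r by (intro powr_mono2) (auto simp: sum_nonneg)
      also have "\<dots> = C powr (1 / r) * R powr (1 - 1 / r) * lp_norm p x"
        using r R C
        by (simp add: finite(1) lp_norm_ereal powr_mult powr_powr S_def sum_nonneg diff_divide_distrib)
      finally show ?thesis using r finite by (simp add: rpow_def one_ereal_def)
    qed
  qed
qed

lemma op_norm_le:
  assumes p: "1 \<le> p" and T: "T \<in> carrier_mat m k" and k: "0 < k"
    and K: "\<And>x. x \<in> carrier_vec k \<Longrightarrow> lp_norm p x = 1 \<Longrightarrow> lp_norm p (T *\<^sub>v x) \<le> K"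
  shows "op_norm p T \<le> K"
proof -
  have "lp_norm p (unit_vec k 0 :: complex vec) = 1" using p k by (rule lp_norm_unit_vec)
  then have "{lp_norm p (T *\<^sub>v x) |x. x \<in> carrier_vec (dim_col T) \<and> lp_norm p x = 1} \<noteq> {}"
    using T by (metis (mono_tags, lifting) carrier_matD(2) empty_Collect_eq unit_vec_carrier)
  then show ?thesis unfolding op_norm_def using K T by (intro cSup_least) auto
qed

text \<open>The supremum defining the operator norm bounds its members only once the set of values is
  known to be bounded above.\<close>

lemma lp_norm_mult_mat_vec_le:
  assumes p: "1 \<le> p" and T: "T \<in> carrier_mat m k" and m: "0 < m" and k: "0 < k"
    and x: "x \<in> carrier_vec k"
  shows "lp_norm p (T *\<^sub>v x) \<le> op_norm p T * lp_norm p x"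
proof (rule lp_norm_mult_mat_vec_homogeneous_le[OF p T m k x])
  fix x assume x: "x \<in> carrier_vec k" "lp_norm p x = 1"
  define S where "S = (\<Sum>i<m. \<Sum>j<k. cmod (T $$ (i, j)))"
  \<comment> \<open>\<open>S\<close> dominates all row and column sums, so Schur's test bounds the set of values.\<close>
  have row: "(\<Sum>j<k. cmod (T $$ (i, j))) \<le> S" if "i < m" for i
    unfolding S_def using that by (intro member_le_sum) (auto simp: sum_nonneg)
  have col: "(\<Sum>i<m. cmod (T $$ (i, j))) \<le> S" if "j < k" for j
    unfolding S_def using that by (intro sum_mono member_le_sum) auto
  have "lp_norm p (T *\<^sub>v x) \<le> Sup {lp_norm p (T *\<^sub>v x) |x. x \<in> carrier_vec k \<and> lp_norm p x = 1}"
  proof (rule cSup_upper)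
    show "bdd_above {lp_norm p (T *\<^sub>v x) |x. x \<in> carrier_vec k \<and> lp_norm p x = 1}"
      using Schur_test[OF p T m k row col] by (intro bdd_aboveI) force
  qed (use x in auto)
  then show "lp_norm p (T *\<^sub>v x) \<le> op_norm p T" using T by (simp add: op_norm_def)
qed

lemma op_norm_nonneg:
  assumes p: "1 \<le> p" and T: "T \<in> carrier_mat m k" and m: "0 < m" and k: "0 < k"
  shows "0 \<le> op_norm p T"
proof -
  have "0 \<le> lp_norm p (T *\<^sub>v unit_vec k 0)" using p m T by (intro lp_norm_nonneg) auto
  also have "\<dots> \<le> op_norm p T"
    using lp_norm_mult_mat_vec_le[OF p T m k, of "unit_vec k 0"] p k by (simp add: lp_norm_unit_vec)
  finally show ?thesis .
qed

lemma op_norm_eq_0_iff: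
  assumes p: "1 \<le> p" and T: "T \<in> carrier_mat m k" and m: "0 < m" and k: "0 < k"
  shows "op_norm p T = 0 \<longleftrightarrow> T = 0\<^sub>m m k"
proof
  assume 0: "op_norm p T = 0"
  show "T = 0\<^sub>m m k"
  proof (rule eq_matI)
    fix i j assume ij: "i < dim_row (0\<^sub>m m k :: complex mat)" "j < dim_col (0\<^sub>m m k :: complex mat)"
    have "cmod ((T *\<^sub>v unit_vec k j) $ i) \<le> lp_norm p (T *\<^sub>v unit_vec k j)"
      using p ij T by (intro cmod_component_le_lp_norm) auto
    also have "\<dots> \<le> 0"
      using lp_norm_mult_mat_vec_le[OF p T m k, of "unit_vec k j"] 0 by simp
    finally show "T $$ (i, j) = 0\<^sub>m m k $$ (i, j)"
      using ij T by simp
  qed (use T in auto)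
next
  assume T0: "T = 0\<^sub>m m k"
  have "op_norm p T \<le> 0"
  proof (rule op_norm_le[OF p T k])
    fix x :: "complex vec" assume "x \<in> carrier_vec k"
    then have "T *\<^sub>v x = 0\<^sub>v m" using T0 by auto
    then show "lp_norm p (T *\<^sub>v x) \<le> 0" using lp_norm_eq_0_iff[OF p zero_carrier_vec m] by simp
  qed
  then show "op_norm p T = 0" using op_norm_nonneg[OF p T m k] by simp
qed

lemma column_sum_le_op_norm_one:
  assumes T: "T \<in> carrier_mat m k" and m: "0 < m" and k: "0 < k" and j: "j < k"
  shows "(\<Sum>i<m. cmod (T $$ (i, j))) \<le> op_norm 1 T"
proof -
  have "(\<Sum>i<m. cmod (T $$ (i, j))) = lp_norm 1 (T *\<^sub>v unit_vec k j)"
    using T j by (simp add: lp_norm_one)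
  also have "\<dots> \<le> op_norm 1 T"
    using lp_norm_mult_mat_vec_le[OF _ T m k, of 1 "unit_vec k j"] j by (simp add: lp_norm_unit_vec)
  finally show ?thesis .
qed

text \<open>A row sum is the \<open>1\<close>-norm of that row, and by duality it is the value of the row at some vector of
  maximum norm \<open>1\<close>.\<close>

lemma row_sum_le_op_norm_infinity:
  assumes T: "T \<in> carrier_mat m k" and m: "0 < m" and k: "0 < k" and i: "i < m"
  shows "(\<Sum>j<k. cmod (T $$ (i, j))) \<le> op_norm \<infinity> T"
proof -
  obtain x where x: "x \<in> carrier_vec k" "lp_norm \<infinity> x = 1"
    and eq: "(\<Sum>j<k. cnj (vec k (\<lambda>j. cnj (T $$ (i, j))) $ j) * x $ j)
      = of_real (lp_norm 1 (vec k (\<lambda>j. cnj (T $$ (i, j)))))"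
    by (rule lp_norm_Holder_attained[of \<infinity> 1 k "vec k (\<lambda>j. cnj (T $$ (i, j)))"]) (use k in auto)
  have "(T *\<^sub>v x) $ i = (\<Sum>j<k. T $$ (i, j) * x $ j)"
    using T x i by (simp add: scalar_prod_def atLeast0LessThan)
  also have "\<dots> = of_real (\<Sum>j<k. cmod (T $$ (i, j)))"
    using eq by (simp add: lp_norm_one)
  finally have "(\<Sum>j<k. cmod (T $$ (i, j))) = cmod ((T *\<^sub>v x) $ i)"
    by (simp add: sum_nonneg del: of_real_sum)
  also have "\<dots> \<le> lp_norm \<infinity> (T *\<^sub>v x)"
    using i T by (intro cmod_component_le_lp_norm) auto
  also have "\<dots> \<le> op_norm \<infinity> T"
    using lp_norm_mult_mat_vec_le[OF _ T m k x(1), of \<infinity>] x(2) by simp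
  finally show ?thesis .
qed

text \<open>The instance of the Riesz-Thorin theorem between the end points \<open>1\<close> and \<open>\<infinity>\<close>. It needs no complex
  analysis, because there the operator norms are the maximal column and row sums, and these are the
  quantities in Schur's test.\<close>

lemma op_norm_interpolation:
  assumes p: "1 \<le> p" and T: "T \<in> carrier_mat m k" and m: "0 < m" and k: "0 < k"
  shows "op_norm p T \<le> rpow (op_norm 1 T) (real_of_ereal (1 / p))
    * rpow (op_norm \<infinity> T) (1 - real_of_ereal (1 / p))"
  using Schur_test[OF p T m k row_sum_le_op_norm_infinity[OF T m k] column_sum_le_op_norm_one[OF T m k]]
  by (intro op_norm_le[OF p T k]) (metis mult.right_neutral)

section \<open>Kronecker products with a rank-one matrix\<close>

definition kron_vec :: "complex vec \<Rightarrow> complex vec \<Rightarrow> complex vec" where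
  "kron_vec u w = vec (dim_vec u * dim_vec w) (\<lambda>r. u $ (r div dim_vec w) * w $ (r mod dim_vec w))"

text \<open>The Kronecker product of the rank-one matrix \<open>a b\<^sup>*\<close> with \<open>A\<close>. The factors may have different
  sizes: with a \<open>1 \<times> 1\<close> matrix \<open>A\<close> the construction contains the rank-one matrices themselves.\<close>
definition rank_one_kron :: "complex vec \<Rightarrow> complex vec \<Rightarrow> complex mat \<Rightarrow> complex mat" where
  "rank_one_kron a b A = mat (dim_vec a * dim_row A) (dim_vec b * dim_col A)
     (\<lambda>(r, c). a $ (r div dim_row A) * cnj (b $ (c div dim_col A)) * A $$ (r mod dim_row A, c mod dim_col A))"

lemma block_index_less:
  fixes j k :: nat
  assumes "j < n" "k < m"
  shows "j * m + k < n * m"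
proof -
  have "j * m + k < Suc j * m" using assms by simp
  also have "\<dots> \<le> n * m" using assms by (intro mult_le_mono1) simp
  finally show ?thesis .
qed

lemma block_index_div:
  fixes j k :: nat
  assumes "k < m"
  shows "(j * m + k) div m = j"
  using assms by simp

lemma block_index_cases:
  fixes r :: nat
  assumes "r < n * m"
  obtains j k where "j < n" "k < m" "r = j * m + k"
proof
  show "r div m < n" using assms by (simp add: less_mult_imp_div_less)
  show "r mod m < m" using assms by (cases m) auto
qed simp

lemma sum_lessThan_blocks:
  fixes f :: "nat \<Rightarrow> 'a :: comm_monoid_add"
  shows "(\<Sum>r<n * m. f r) = (\<Sum>j<n. \<Sum>k<m. f (j * m + k))"
proof -
  have "(\<Sum>k<m. f (j * m + k)) = sum f {j * m..<j * m + m}" for j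
    using sum.shift_bounds_nat_ivl[of f 0 "j * m" m] by (simp add: atLeast0LessThan add.commute)
  then show ?thesis by (simp add: sum.nat_group)
qed

text \<open>Fubini for \<open>p\<close>-norms: a vector of \<open>n\<close> blocks of length \<open>m\<close> may be measured by first taking the norm
  across the blocks at each position \<open>k\<close>, and then the norm over \<open>k\<close>.\<close>

lemma lp_norm_blocks:
  assumes p: "1 \<le> p" and x: "x \<in> carrier_vec (n * m)" and n: "0 < n" and m: "0 < m"
  shows "lp_norm p (vec m (\<lambda>k. of_real (lp_norm p (vec n (\<lambda>j. x $ (j * m + k)))))) = lp_norm p x"
    (is "lp_norm p ?w = _")
proof -
  define s where "s k = lp_norm p (vec n (\<lambda>j. x $ (j * m + k)))" for k
  have s: "0 \<le> s k" for k unfolding s_def using p n by (intro lp_norm_nonneg) auto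
  have w: "?w = vec m (\<lambda>k. of_real (s k))" by (simp add: s_def)
  show ?thesis
    using p
  proof (cases rule: extended_exponent_cases)
    case infinite
    have s_le: "s k \<le> K \<longleftrightarrow> (\<forall>j<n. cmod (x $ (j * m + k)) \<le> K)" for k K
      using n by (simp add: s_def infinite lp_norm_infinity_le_iff)
    have w_le: "lp_norm \<infinity> ?w \<le> K \<longleftrightarrow> (\<forall>k<m. s k \<le> K)" for K
      using m s by (simp add: w lp_norm_infinity_le_iff)
    have x_le: "lp_norm \<infinity> x \<le> K \<longleftrightarrow> (\<forall>r<n * m. cmod (x $ r) \<le> K)" for K
      using m n x by (simp add: lp_norm_infinity_le_iff)
    have "lp_norm \<infinity> ?w \<le> K \<longleftrightarrow> lp_norm \<infinity> x \<le> K" for K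
    proof -
      have "(\<forall>r<n * m. cmod (x $ r) \<le> K) \<longleftrightarrow> (\<forall>j<n. \<forall>k<m. cmod (x $ (j * m + k)) \<le> K)"
        by (metis block_index_cases block_index_less)
      then show ?thesis unfolding w_le x_le s_le by blast
    qed
    from this[of "lp_norm \<infinity> x"] this[of "lp_norm \<infinity> ?w"]
    have "lp_norm \<infinity> ?w = lp_norm \<infinity> x" by simp
    then show ?thesis by (simp only: infinite)
  next
    case (finite r)
    have "(\<Sum>k<m. cmod (?w $ k) powr r) = (\<Sum>k<m. s k powr r)"
      unfolding w using s by simp
    also have "\<dots> = (\<Sum>k<m. \<Sum>j<n. cmod (x $ (j * m + k)) powr r)"
      using finite by (simp add: s_def lp_norm_ereal_powr)
    also have "\<dots> = (\<Sum>i<n * m. cmod (x $ i) powr r)"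
      by (subst sum.swap) (simp add: sum_lessThan_blocks)
    finally show ?thesis using x finite by (simp add: lp_norm_ereal)
  qed
qed

lemma lp_norm_kron_vec:
  assumes p: "1 \<le> p" and n: "0 < dim_vec u" and m: "0 < dim_vec w"
  shows "lp_norm p (kron_vec u w) = lp_norm p u * lp_norm p w"
proof -
  let ?n = "dim_vec u" and ?m = "dim_vec w"
  have slice: "vec ?n (\<lambda>j. kron_vec u w $ (j * ?m + k)) = w $ k \<cdot>\<^sub>v u" if "k < ?m" for k
  proof (rule eq_vecI)
    fix j assume "j < dim_vec (w $ k \<cdot>\<^sub>v u)"
    then show "vec ?n (\<lambda>j. kron_vec u w $ (j * ?m + k)) $ j = (w $ k \<cdot>\<^sub>v u) $ j"
      using that by (simp add: kron_vec_def block_index_less block_index_div)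
  qed simp
  have "lp_norm p (kron_vec u w)
      = lp_norm p (vec ?m (\<lambda>k. of_real (lp_norm p (vec ?n (\<lambda>j. kron_vec u w $ (j * ?m + k))))))"
    using n m by (intro lp_norm_blocks[OF p, symmetric]) (auto simp: kron_vec_def)
  also have "\<dots> = lp_norm p (of_real (lp_norm p u) \<cdot>\<^sub>v w)"
    using p n m slice
    by (intro lp_norm_cong_cmod) (auto simp: lp_norm_smult norm_mult)
  also have "\<dots> = lp_norm p u * lp_norm p w"
    using p n m by (simp add: lp_norm_smult lp_norm_nonneg)
  finally show ?thesis .
qed

lemma rank_one_kron_carrier:
  assumes "a \<in> carrier_vec n" "b \<in> carrier_vec n'" "A \<in> carrier_mat m m'"
  shows "rank_one_kron a b A \<in> carrier_mat (n * m) (n' * m')"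
  using assms by (auto simp: rank_one_kron_def)

text \<open>The Kronecker product factors through a single vector: the blocks of \<open>x\<close> are combined with the
  coefficients \<open>cnj b\<^sub>j\<close>, \<open>A\<close> is applied, and the result is distributed with the coefficients \<open>a\<^sub>i\<close>.\<close>

lemma rank_one_kron_mult_vec:
  assumes a: "a \<in> carrier_vec n" and b: "b \<in> carrier_vec n'" and A: "A \<in> carrier_mat m m'"
    and x: "x \<in> carrier_vec (n' * m')"
  shows "rank_one_kron a b A *\<^sub>v x
    = kron_vec a (A *\<^sub>v vec m' (\<lambda>l. \<Sum>j<n'. cnj (b $ j) * x $ (j * m' + l)))" (is "_ = kron_vec a (A *\<^sub>v ?y)")
proof (rule eq_vecI)
  show "dim_vec (rank_one_kron a b A *\<^sub>v x) = dim_vec (kron_vec a (A *\<^sub>v ?y))"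
    using a A by (simp add: rank_one_kron_def kron_vec_def)
  fix r assume "r < dim_vec (kron_vec a (A *\<^sub>v ?y))"
  then have r: "r < n * m" using a A by (simp add: kron_vec_def)
  then obtain i k where ik: "i < n" "k < m" "r = i * m + k" by (rule block_index_cases)
  have "(rank_one_kron a b A *\<^sub>v x) $ r
      = (\<Sum>c<n' * m'. a $ i * cnj (b $ (c div m')) * A $$ (k, c mod m') * x $ c)"
    using a b A x r ik by (simp add: rank_one_kron_def scalar_prod_def atLeast0LessThan)
  also have "\<dots> = (\<Sum>j<n'. \<Sum>l<m'. a $ i * cnj (b $ j) * A $$ (k, l) * x $ (j * m' + l))"
    by (simp add: sum_lessThan_blocks)
  also have "\<dots> = a $ i * (\<Sum>l<m'. A $$ (k, l) * (\<Sum>j<n'. cnj (b $ j) * x $ (j * m' + l)))"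
    by (subst sum.swap) (simp add: sum_distrib_left mult_ac)
  also have "\<dots> = kron_vec a (A *\<^sub>v ?y) $ r"
    using a A r ik by (simp add: kron_vec_def scalar_prod_def atLeast0LessThan)
  finally show "(rank_one_kron a b A *\<^sub>v x) $ r = kron_vec a (A *\<^sub>v ?y) $ r" .
qed

text \<open>The combination of blocks has norm at most \<open>\<parallel>b\<parallel>\<^sub>q \<parallel>x\<parallel>\<^sub>p\<close>; hence the upper bound. For the lower
  bound, test on \<open>u \<otimes> \<xi>\<close> with \<open>u\<close> extremal for Holder's inequality against \<open>b\<close>: the combined block is
  then exactly \<open>\<parallel>b\<parallel>\<^sub>q \<xi>\<close>, and \<open>\<xi>\<close> is free to exhaust the norm of \<open>A\<close>.\<close>

lemma op_norm_rank_one_kron: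
  assumes pq: "1 \<le> p" "1 \<le> q" "1 / p + 1 / q = 1"
    and a: "a \<in> carrier_vec n" and b: "b \<in> carrier_vec n'" and A: "A \<in> carrier_mat m m'"
    and pos: "0 < n" "0 < n'" "0 < m" "0 < m'"
  shows "op_norm p (rank_one_kron a b A) = lp_norm p a * lp_norm q b * op_norm p A"
proof (rule antisym)
  note p = pq(1)
  have nn: "0 \<le> lp_norm p a" "0 \<le> lp_norm q b" "0 \<le> op_norm p A"
    using lp_norm_nonneg[OF p, of a] lp_norm_nonneg[OF pq(2), of b]
      op_norm_nonneg[OF p A pos(3,4)] a b pos by auto
  have K: "rank_one_kron a b A \<in> carrier_mat (n * m) (n' * m')"
    using a b A by (rule rank_one_kron_carrier)
  have kron_norm: "lp_norm p (kron_vec a (A *\<^sub>v y)) = lp_norm p a * lp_norm p (A *\<^sub>v y)" for y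
    using p a A pos by (simp add: lp_norm_kron_vec)
  show "op_norm p (rank_one_kron a b A) \<le> lp_norm p a * lp_norm q b * op_norm p A"
  proof (rule op_norm_le[OF p K])
    show "0 < n' * m'" using pos by simp
    fix x assume x: "x \<in> carrier_vec (n' * m')" "lp_norm p x = 1"
    define s where "s l = lp_norm p (vec n' (\<lambda>j. x $ (j * m' + l)))" for l
    have s: "0 \<le> s l" for l unfolding s_def using p pos by (intro lp_norm_nonneg) auto
    define y where "y = vec m' (\<lambda>l. \<Sum>j<n'. cnj (b $ j) * x $ (j * m' + l))"
    \<comment> \<open>Holder's inequality at each position inside the blocks, followed by the Fubini identity;
      this replaces Minkowski's inequality for the sum of the blocks.\<close>
    have "cmod (y $ l) \<le> lp_norm q b * s l" if "l < m'" for l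
      using lp_norm_Holder[OF pq pos(2) b, of "vec n' (\<lambda>j. x $ (j * m' + l))"] that
      by (simp add: y_def s_def)
    then have "lp_norm p y \<le> lp_norm p (of_real (lp_norm q b) \<cdot>\<^sub>v vec m' (\<lambda>l. of_real (s l)))"
      using p pos nn s by (intro lp_norm_mono) (auto simp: y_def norm_mult)
    also have "\<dots> = lp_norm q b * lp_norm p x"
      using p pos nn x lp_norm_blocks[OF p x(1)] by (simp add: lp_norm_smult s_def)
    finally have y: "lp_norm p y \<le> lp_norm q b" using x by simp
    have "lp_norm p (rank_one_kron a b A *\<^sub>v x) = lp_norm p a * lp_norm p (A *\<^sub>v y)"
      by (simp add: rank_one_kron_mult_vec[OF a b A x(1)] kron_norm y_def)
    also have "\<dots> \<le> lp_norm p a * (op_norm p A * lp_norm p y)"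
      using nn lp_norm_mult_mat_vec_le[OF p A pos(3,4), of y] by (intro mult_left_mono) (auto simp: y_def)
    also have "\<dots> \<le> lp_norm p a * (op_norm p A * lp_norm q b)"
      using nn y by (intro mult_left_mono) auto
    finally show "lp_norm p (rank_one_kron a b A *\<^sub>v x) \<le> lp_norm p a * lp_norm q b * op_norm p A"
      by (simp add: mult_ac)
  qed
  obtain u where u: "u \<in> carrier_vec n'" "lp_norm p u = 1"
    and ub: "(\<Sum>j<n'. cnj (b $ j) * u $ j) = of_real (lp_norm q b)"
    using lp_norm_Holder_attained[OF pq pos(2) b] .
  have lower: "lp_norm p a * lp_norm q b * lp_norm p (A *\<^sub>v \<xi>) \<le> op_norm p (rank_one_kron a b A)"
    if \<xi>: "\<xi> \<in> carrier_vec m'" "lp_norm p \<xi> = 1" for \<xi>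
  proof -
    have x: "kron_vec u \<xi> \<in> carrier_vec (n' * m')" "lp_norm p (kron_vec u \<xi>) = 1"
    proof -
      show "kron_vec u \<xi> \<in> carrier_vec (n' * m')" using u \<xi> by (auto simp: kron_vec_def)
      show "lp_norm p (kron_vec u \<xi>) = 1" using u \<xi> p pos by (simp add: lp_norm_kron_vec)
    qed
    have "vec m' (\<lambda>l. \<Sum>j<n'. cnj (b $ j) * kron_vec u \<xi> $ (j * m' + l))
        = of_real (lp_norm q b) \<cdot>\<^sub>v \<xi>"
    proof (rule eq_vecI)
      fix l assume "l < dim_vec (of_real (lp_norm q b) \<cdot>\<^sub>v \<xi>)"
      then have l: "l < m'" using \<xi> by simp
      have "(\<Sum>j<n'. cnj (b $ j) * kron_vec u \<xi> $ (j * m' + l))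
          = (\<Sum>j<n'. (cnj (b $ j) * u $ j) * \<xi> $ l)"
        using l u \<xi> by (intro sum.cong) (auto simp: kron_vec_def block_index_less)
      also have "\<dots> = of_real (lp_norm q b) * \<xi> $ l"
        by (simp add: ub flip: sum_distrib_right)
      finally show "vec m' (\<lambda>l. \<Sum>j<n'. cnj (b $ j) * kron_vec u \<xi> $ (j * m' + l)) $ l
          = (of_real (lp_norm q b) \<cdot>\<^sub>v \<xi>) $ l"
        using l \<xi> by simp
    qed (use \<xi> in simp)
    then have "rank_one_kron a b A *\<^sub>v kron_vec u \<xi>
        = kron_vec a (A *\<^sub>v (of_real (lp_norm q b) \<cdot>\<^sub>v \<xi>))"
      by (simp only: rank_one_kron_mult_vec[OF a b A x(1)])
    moreover have "lp_norm p (A *\<^sub>v (of_real (lp_norm q b) \<cdot>\<^sub>v \<xi>)) = lp_norm q b * lp_norm p (A *\<^sub>v \<xi>)"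
      using p A \<xi> pos nn by (simp add: mult_mat_vec lp_norm_smult)
    ultimately have "lp_norm p (rank_one_kron a b A *\<^sub>v kron_vec u \<xi>)
        = lp_norm p a * (lp_norm q b * lp_norm p (A *\<^sub>v \<xi>))"
      by (simp only: kron_norm)
    then show ?thesis
      using lp_norm_mult_mat_vec_le[OF p K _ _ x(1)] x(2) pos by (simp add: mult.assoc)
  qed
  show "lp_norm p a * lp_norm q b * op_norm p A \<le> op_norm p (rank_one_kron a b A)"
  proof (cases "lp_norm p a * lp_norm q b = 0")
    case True
    then show ?thesis using op_norm_nonneg[OF p K] pos by (auto simp del: mult_eq_0_iff)
  next
    case False
    then have c: "0 < lp_norm p a * lp_norm q b" using nn by (auto simp: less_le)
    have "op_norm p A \<le> op_norm p (rank_one_kron a b A) / (lp_norm p a * lp_norm q b)"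
      using lower c by (intro op_norm_le[OF p A pos(4)]) (simp add: pos_le_divide_eq mult.commute)
    then show ?thesis using c by (simp add: pos_le_divide_eq mult.commute)
  qed
qed

section \<open>Logarithmic affinity of Kronecker products\<close>

lemma op_norm_one_dim:
  assumes p: "1 \<le> p" and A: "A \<in> carrier_mat 1 1"
  shows "op_norm p A = cmod (A $$ (0, 0))"
proof -
  have act: "A *\<^sub>v x = A $$ (0, 0) \<cdot>\<^sub>v x" if "x \<in> carrier_vec 1" for x
    using that A by (intro eq_vecI) (auto simp: scalar_prod_def)
  have norm: "lp_norm p (A *\<^sub>v x) = cmod (A $$ (0, 0)) * lp_norm p x" if "x \<in> carrier_vec 1" for x
    using that p by (simp add: act lp_norm_smult)
  show ?thesis
  proof (rule antisym)
    show "op_norm p A \<le> cmod (A $$ (0, 0))"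
      using norm by (intro op_norm_le[OF p A]) auto
    show "cmod (A $$ (0, 0)) \<le> op_norm p A"
      using lp_norm_mult_mat_vec_le[OF p A, of "unit_vec 1 0"] norm[of "unit_vec 1 0"] p
      by (simp add: lp_norm_unit_vec)
  qed
qed

lemma rpow_mult: "0 \<le> x \<Longrightarrow> 0 \<le> y \<Longrightarrow> rpow (x * y) s = rpow x s * rpow y s"
  by (simp add: rpow_def powr_mult)

lemma rpow_complementary_powers:
  assumes "0 \<le> x"
  shows "rpow x s * rpow x (1 - s) = x"
  using assms by (auto simp: rpow_def simp flip: powr_add)

lemma one_dim_mat_in_LA:
  assumes "A \<in> carrier_mat 1 1"
  shows "A \<in> LA 1"
  using assms by (simp add: LA_def op_norm_one_dim rpow_complementary_powers)

lemma first_col_mat_eq_rank_one_kron: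
  assumes "a \<in> carrier_vec n" "0 < n"
  shows "first_col_mat a = rank_one_kron a (unit_vec n 0) (1\<^sub>m 1)"
  using assms by (intro eq_matI) (auto simp: first_col_mat_def rank_one_kron_def)

lemma first_row_mat_eq_rank_one_kron:
  assumes "b \<in> carrier_vec n" "0 < n"
  shows "first_row_mat b = rank_one_kron (unit_vec n 0) b (1\<^sub>m 1)"
  using assms by (intro eq_matI) (auto simp: first_row_mat_def rank_one_kron_def)

lemma block_mod_less:
  fixes r :: nat
  assumes "r < n * m"
  shows "r mod m < m"
  using assms by (cases m) auto

lemma block_mat_eq_rank_one_kron:
  assumes "a \<in> carrier_vec n" "b \<in> carrier_vec n" "A \<in> carrier_mat n n"
  shows "block_mat n (\<lambda>i j. (a $ i * cnj (b $ j)) \<cdot>\<^sub>m A) = rank_one_kron a b A"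
  using assms
  by (intro eq_matI) (auto simp: block_mat_def rank_one_kron_def block_mod_less[where n = n and m = n])

lemma op_norm_first_col_mat:
  assumes p: "1 \<le> p" and a: "a \<in> carrier_vec n" and n: "0 < n"
  shows "op_norm p (first_col_mat a) = lp_norm p a"
proof -
  obtain q :: ereal where q: "1 \<le> q" "1 / p + 1 / q = 1" using p by (rule conjugate_exponent_exists)
  show ?thesis
    using op_norm_rank_one_kron[OF p q a unit_vec_carrier one_carrier_mat n n, of 1 0] p q n
    by (simp add: first_col_mat_eq_rank_one_kron[OF a n] lp_norm_unit_vec op_norm_one_dim)
qed

lemma op_norm_first_row_mat:
  assumes pq: "1 \<le> p" "1 \<le> q" "1 / p + 1 / q = 1" and b: "b \<in> carrier_vec n" and n: "0 < n"
  shows "op_norm p (first_row_mat b) = lp_norm q b"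
  using op_norm_rank_one_kron[OF pq unit_vec_carrier b one_carrier_mat n n, of 1 0] pq n
  by (simp add: first_row_mat_eq_rank_one_kron[OF b n] lp_norm_unit_vec op_norm_one_dim)

text \<open>Slack in any single factor would survive multiplication by the other, positive, factors.\<close>

lemma product_equality_imp_factor_equalities:
  fixes a b c a' b' c' :: real
  assumes "0 < a" "0 < b" "0 < c" and le: "a \<le> a'" "b \<le> b'" "c \<le> c'" and eq: "a * b * c = a' * b' * c'"
  shows "a = a'" "b = b'" "c = c'"
proof -
  have 1: "a * b * c \<le> a' * b * c" using assms by (intro mult_right_mono) auto
  have 2: "a' * b * c \<le> a' * b' * c" using assms by (intro mult_right_mono mult_left_mono) auto
  have 3: "a' * b' * c \<le> a' * b' * c'" using assms by (intro mult_left_mono) auto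
  have "a * b * c = a' * b * c" using 1 2 3 eq by linarith
  then show "a = a'" using assms(2,3) by simp
  have "a' * b * c = a' * b' * c" using 1 2 3 eq by linarith
  then show "b = b'" using assms(1,3) le(1) by simp
  have "a' * b' * c = a' * b' * c'" using 1 2 3 eq by linarith
  then show "c = c'" using assms(1,2) le by simp
qed

theorem theorem4p6:
  fixes n :: nat and \<alpha> \<beta> :: "complex vec" and A B :: "complex mat"
  assumes n: "n \<ge> 1"
    and \<alpha>: "\<alpha> \<in> carrier_vec n"
    and \<beta>: "\<beta> \<in> carrier_vec n"
    and A: "A \<in> carrier_mat n n"
    and B: "B = block_mat n (\<lambda>i j. (\<alpha> $ i * cnj (\<beta> $ j)) \<cdot>\<^sub>m A)"
  shows "(\<forall>p q :: ereal. 1 \<le> p \<and> 1 \<le> q \<and> 1 / p + 1 / q = 1 \<longrightarrow>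
            op_norm p B = lp_norm p \<alpha> * lp_norm q \<beta> * op_norm p A)
       \<and> (first_col_mat \<alpha> \<in> LA n \<and> first_row_mat \<beta> \<in> LA n \<and> A \<in> LA n \<longrightarrow> B \<in> LA (n\<^sup>2))
       \<and> (B \<noteq> 0\<^sub>m (n\<^sup>2) (n\<^sup>2) \<or> n = 1 \<longrightarrow>
            (B \<in> LA (n\<^sup>2) \<longleftrightarrow>
               first_col_mat \<alpha> \<in> LA n \<and> first_row_mat \<beta> \<in> LA n \<and> A \<in> LA n))"
proof -
  have n0: "0 < n" using n by simp
  let ?C = "first_col_mat \<alpha>" and ?R = "first_row_mat \<beta>"
  let ?s = "\<lambda>p :: ereal. real_of_ereal (1 / p)"
  let ?I = "\<lambda>T p. rpow (op_norm 1 T) (?s p) * rpow (op_norm \<infinity> T) (1 - ?s p)"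
  have Bk: "B = rank_one_kron \<alpha> \<beta> A"
    unfolding B using \<alpha> \<beta> A by (rule block_mat_eq_rank_one_kron)
  have C: "?C \<in> carrier_mat n n" and R: "?R \<in> carrier_mat n n"
    using \<alpha> \<beta> by (auto simp: first_col_mat_def first_row_mat_def)
  have Bc: "B \<in> carrier_mat (n * n) (n * n)"
    unfolding Bk using \<alpha> \<beta> A by (rule rank_one_kron_carrier)
  have part1: "op_norm p B = lp_norm p \<alpha> * lp_norm q \<beta> * op_norm p A"
    if "1 \<le> p" "1 \<le> q" "1 / p + 1 / q = 1" for p q :: ereal
    unfolding Bk using that \<alpha> \<beta> A n0 n0 n0 n0 by (rule op_norm_rank_one_kron)
  \<comment> \<open>With the norms of \<open>C(\<alpha>)\<close> and \<open>R(\<beta>)\<close> in place of those of the vectors, the conjugate exponent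
    disappears and both sides of the equation defining \<open>LA\<close> become multiplicative.\<close>
  have norm_B: "op_norm p B = op_norm p ?C * op_norm p ?R * op_norm p A" if p: "1 \<le> p" for p
  proof -
    obtain q :: ereal where q: "1 \<le> q" "1 / p + 1 / q = 1" using p by (rule conjugate_exponent_exists)
    show ?thesis
      by (simp add: part1[OF p q] op_norm_first_col_mat[OF p \<alpha> n0] op_norm_first_row_mat[OF p q \<beta> n0])
  qed
  have one: "1 \<le> (1 :: ereal)" and inf: "1 \<le> (\<infinity> :: ereal)" by auto
  have nn: "0 \<le> op_norm p T" if "1 \<le> p" "T \<in> carrier_mat n n" for p T
    using op_norm_nonneg[OF that n0 n0] .
  have I_B: "?I B p = ?I ?C p * ?I ?R p * ?I A p" for p
    unfolding norm_B[OF one] norm_B[OF inf]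
    by (simp only: rpow_mult nn[OF one C] nn[OF one R] nn[OF one A] nn[OF inf C] nn[OF inf R]
        nn[OF inf A] mult_nonneg_nonneg) (simp only: mult_ac)
  have LA_B: "B \<in> LA (n\<^sup>2) \<longleftrightarrow> (\<forall>p. 1 \<le> p \<longrightarrow> op_norm p B = ?I B p)"
    using Bc by (simp add: LA_def power2_eq_square)
  have LA_iff: "T \<in> LA n \<longleftrightarrow> (\<forall>p. 1 \<le> p \<longrightarrow> op_norm p T = ?I T p)" if "T \<in> carrier_mat n n" for T
    using that by (simp add: LA_def)
  have suff: "B \<in> LA (n\<^sup>2)" if LA: "?C \<in> LA n" "?R \<in> LA n" "A \<in> LA n"
    unfolding LA_B
  proof (intro allI impI)
    fix p :: ereal assume p: "1 \<le> p"
    have eqs: "op_norm p ?C = ?I ?C p" "op_norm p ?R = ?I ?R p" "op_norm p A = ?I A p"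
      using LA p LA_iff[OF C] LA_iff[OF R] LA_iff[OF A] by blast+
    have "op_norm p B = op_norm p ?C * op_norm p ?R * op_norm p A" by (rule norm_B[OF p])
    also have "\<dots> = ?I ?C p * ?I ?R p * ?I A p" by (intro arg_cong2[where f = times] eqs)
    also have "\<dots> = ?I B p" by (rule I_B[symmetric])
    finally show "op_norm p B = ?I B p" .
  qed
  have nec: "?C \<in> LA n \<and> ?R \<in> LA n \<and> A \<in> LA n" if LA: "B \<in> LA (n\<^sup>2)" and nz: "B \<noteq> 0\<^sub>m (n\<^sup>2) (n\<^sup>2)"
  proof -
    have "op_norm p ?C = ?I ?C p \<and> op_norm p ?R = ?I ?R p \<and> op_norm p A = ?I A p"
      if p: "1 \<le> p" for p
    proof -
      have "op_norm p B \<noteq> 0"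
        using nz op_norm_eq_0_iff[OF p Bc] n0 by (simp add: power2_eq_square)
      then have pos: "0 < op_norm p ?C" "0 < op_norm p ?R" "0 < op_norm p A"
        using nn[OF p C] nn[OF p R] nn[OF p A] unfolding norm_B[OF p] by (simp_all add: less_le)
      have eq: "op_norm p ?C * op_norm p ?R * op_norm p A = ?I ?C p * ?I ?R p * ?I A p"
      proof -
        have "op_norm p B = ?I B p" using LA p unfolding LA_B by blast
        from trans[OF norm_B[OF p, symmetric] trans[OF this I_B]] show ?thesis .
      qed
      show ?thesis
        using product_equality_imp_factor_equalities[OF pos
            op_norm_interpolation[OF p C n0 n0] op_norm_interpolation[OF p R n0 n0]
            op_norm_interpolation[OF p A n0 n0] eq]
        by blast
    qed
    then show ?thesis unfolding LA_iff[OF C] LA_iff[OF R] LA_iff[OF A] by blast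
  qed
  have one_dim: "?C \<in> LA n \<and> ?R \<in> LA n \<and> A \<in> LA n" if "n = 1"
    using one_dim_mat_in_LA C R A unfolding that by blast
  show ?thesis
  proof (intro conjI[OF _ conjI] allI impI)
    show "op_norm p B = lp_norm p \<alpha> * lp_norm q \<beta> * op_norm p A"
      if "1 \<le> p \<and> 1 \<le> q \<and> 1 / p + 1 / q = 1" for p q
      using part1 that by blast
    show "B \<in> LA (n\<^sup>2)" if "?C \<in> LA n \<and> ?R \<in> LA n \<and> A \<in> LA n"
      using suff that by blast
    show "B \<in> LA (n\<^sup>2) \<longleftrightarrow> ?C \<in> LA n \<and> ?R \<in> LA n \<and> A \<in> LA n"
      if "B \<noteq> 0\<^sub>m (n\<^sup>2) (n\<^sup>2) \<or> n = 1"
      using suff nec one_dim that by blast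
  qed
qed

end
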